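(* Let $f$ be a choice function for $L$ of the form $f=\min_<$ for some regular total ordering $<$ of $Sen(L)$. Then $f$ is $\neg$-decreasing if and only if for every truth assignment $M$ and all $\varphi,\psi\in Sen(L_s)$, $$\langle M,f\rangle\models_s\varphi\wedge\neg\psi\rightarrow(\varphi|\psi\leftrightarrow\neg\varphi|\neg\psi).$$
   Context: $L$ is the propositional language with atoms $p_0,p_1,\ldots$ and connectives $\neg,\wedge$ (others defined); $L_s$ adds a primitive binary connective $|$. $\sim$ is classical equivalence on $Sen(L)$, $[\alpha]=\{\beta:\beta\sim\alpha\}$. A total ordering $<$ of $Sen(L)$ is regular if $\alpha\not\sim\beta$ and $\alpha<\beta$ imply $\alpha'<\beta'$ for all $\alpha'\in[\alpha],\beta'\in[\beta]$; it is $\neg$-decreasing if for all $\alpha\not\sim\beta$: $\alpha<\beta\iff\neg\beta<\neg\alpha$. A choice function for $L$ is a map $f$ with $f(\alpha,\beta)=f(\{\alpha,\beta\})\in\{\alpha,\beta\}$; such $f=\min_<$ (with $<$ regular total) is $\neg$-decreasing if $<$ is $\neg$-decreasing. $f$ induces $\overline f:Sen(L_s)\to Sen(L)$: identity on $Sen(L)$, commuting with $\neg,\wedge$, and $\overline f(\varphi|\psi)=f(\overline f(\varphi),\overline f(\psi))$. For a truth assignment $M$ of $Sen(L)$, $\langle M,f\rangle\models_s\varphi$ iff $M\models\overline f(\varphi)$. *)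

theory Defs
  imports Main
begin

datatype form = Atom nat | Neg form | Conj form form

datatype sform = SAtom nat | SNeg sform | SConj sform sform | SChoice sform sform

definition SImp :: "sform \<Rightarrow> sform \<Rightarrow> sform" where
  "SImp \<phi> \<psi> = SNeg (SConj \<phi> (SNeg \<psi>))"

definition SIff :: "sform \<Rightarrow> sform \<Rightarrow> sform" where
  "SIff \<phi> \<psi> = SConj (SImp \<phi> \<psi>) (SImp \<psi> \<phi>)"

text \<open>A truth assignment is given by its values on the atoms.\<close>

type_synonym assignment = "nat \<Rightarrow> bool"

primrec sat :: "assignment \<Rightarrow> form \<Rightarrow> bool" where
  "sat M (Atom n) = M n"
| "sat M (Neg \<alpha>) = (\<not> sat M \<alpha>)"
| "sat M (Conj \<alpha> \<beta>) = (sat M \<alpha> \<and> sat M \<beta>)"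

definition equiv_form :: "form \<Rightarrow> form \<Rightarrow> bool" where
  "equiv_form \<alpha> \<beta> \<longleftrightarrow> (\<forall>M. sat M \<alpha> = sat M \<beta>)"

definition eq_class :: "form \<Rightarrow> form set" where
  "eq_class \<alpha> = {\<beta>. equiv_form \<beta> \<alpha>}"

text \<open>Orderings are strict, and total on sentences themselves, not merely on their
  equivalence classes.\<close>

definition total_ordering :: "(form \<Rightarrow> form \<Rightarrow> bool) \<Rightarrow> bool" where
  "total_ordering lt \<longleftrightarrow> irreflp lt \<and> transp lt \<and> totalp lt"

definition regular :: "(form \<Rightarrow> form \<Rightarrow> bool) \<Rightarrow> bool" where
  "regular lt \<longleftrightarrow>
    (\<forall>\<alpha> \<beta>. \<not> equiv_form \<alpha> \<beta> \<and> lt \<alpha> \<beta> \<longrightarrow>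
      (\<forall>\<alpha>'\<in>eq_class \<alpha>. \<forall>\<beta>'\<in>eq_class \<beta>. lt \<alpha>' \<beta>'))"

definition neg_decreasing :: "(form \<Rightarrow> form \<Rightarrow> bool) \<Rightarrow> bool" where
  "neg_decreasing lt \<longleftrightarrow>
    (\<forall>\<alpha> \<beta>. \<not> equiv_form \<alpha> \<beta> \<longrightarrow> (lt \<alpha> \<beta> \<longleftrightarrow> lt (Neg \<beta>) (Neg \<alpha>)))"

text \<open>A choice function acts on the unordered pair \<open>{\<alpha>, \<beta>}\<close>; as a binary operation
  this means that it is symmetric.\<close>

definition choice_function :: "(form \<Rightarrow> form \<Rightarrow> form) \<Rightarrow> bool" where
  "choice_function f \<longleftrightarrow> (\<forall>\<alpha> \<beta>. f \<alpha> \<beta> = f \<beta> \<alpha> \<and> f \<alpha> \<beta> \<in> {\<alpha>, \<beta>})"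

definition min_of :: "(form \<Rightarrow> form \<Rightarrow> bool) \<Rightarrow> form \<Rightarrow> form \<Rightarrow> form" where
  "min_of lt \<alpha> \<beta> = (if lt \<alpha> \<beta> then \<alpha> else \<beta>)"

text \<open>By \<open>min_of_inject\<close> below, the ordering that represents \<open>f\<close> is unique, so the
  existential quantifier here refers to the ordering of \<open>f\<close>.\<close>

definition neg_decreasing_choice :: "(form \<Rightarrow> form \<Rightarrow> form) \<Rightarrow> bool" where
  "neg_decreasing_choice f \<longleftrightarrow>
    (\<exists>lt. total_ordering lt \<and> regular lt \<and> f = min_of lt \<and> neg_decreasing lt)"

primrec collapse :: "(form \<Rightarrow> form \<Rightarrow> form) \<Rightarrow> sform \<Rightarrow> form" where
  "collapse f (SAtom n) = Atom n"
| "collapse f (SNeg \<phi>) = Neg (collapse f \<phi>)"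
| "collapse f (SConj \<phi> \<psi>) = Conj (collapse f \<phi>) (collapse f \<psi>)"
| "collapse f (SChoice \<phi> \<psi>) = f (collapse f \<phi>) (collapse f \<psi>)"

definition models_s :: "assignment \<Rightarrow> (form \<Rightarrow> form \<Rightarrow> form) \<Rightarrow> sform \<Rightarrow> bool" where
  "models_s M f \<phi> \<longleftrightarrow> sat M (collapse f \<phi>)"

primrec embed :: "form \<Rightarrow> sform" where
  "embed (Atom n) = SAtom n"
| "embed (Neg \<alpha>) = SNeg (embed \<alpha>)"
| "embed (Conj \<alpha> \<beta>) = SConj (embed \<alpha>) (embed \<beta>)"

lemma collapse_embed: "collapse f (embed \<alpha>) = \<alpha>"
  by (induction \<alpha>) simp_all

lemma choice_function_min_of: "total_ordering lt \<Longrightarrow> choice_function (min_of lt)"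
  unfolding total_ordering_def choice_function_def min_of_def irreflp_def transp_def totalp_on_def
  by (smt (verit) UNIV_I insertCI)

lemma min_of_inject:
  assumes "total_ordering r" "total_ordering s" "min_of r = min_of s"
  shows "r = s"
proof (intro ext)
  fix \<alpha> \<beta>
  have "min_of r \<alpha> \<beta> = min_of s \<alpha> \<beta>"
    using assms(3) by simp
  moreover have "\<not> r \<alpha> \<alpha>" "\<not> s \<alpha> \<alpha>"
    using assms by (auto simp: total_ordering_def irreflp_def)
  ultimately show "r \<alpha> \<beta> = s \<alpha> \<beta>"
    by (cases "\<alpha> = \<beta>") (auto simp: min_of_def split: if_splits)
qed

end

theory Submission
  imports Defs
begin

text \<open>If \<open>M\<close> satisfies \<open>\<alpha> \<and> \<not>\<beta>\<close>, then the truth value in \<open>M\<close> of the choice from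
  \<open>{\<alpha>, \<beta>}\<close> reveals which of the two was chosen, and likewise for \<open>{\<not>\<alpha>, \<not>\<beta>}\<close>. Hence
  the scheme says that \<open>\<alpha> < \<beta> \<longleftrightarrow> \<not>\<beta> < \<not>\<alpha>\<close> whenever \<open>\<alpha> \<and> \<not>\<beta>\<close> is satisfiable. Two
  inequivalent sentences satisfy this condition in at least one order, and by totality
  the two orders give the same equivalence.\<close>

lemma total_ordering_not_iff:
  assumes "total_ordering lt" "\<alpha> \<noteq> \<beta>"
  shows "\<not> lt \<alpha> \<beta> \<longleftrightarrow> lt \<beta> \<alpha>"
  using assms unfolding total_ordering_def irreflp_def transp_def totalp_on_def by blast

text \<open>The second form carries a negation because \<open>min_of\<close> falls back on its
  second argument when \<open>lt\<close> fails.\<close>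

lemma sat_min_of:
  assumes "sat M \<alpha>" "\<not> sat M \<beta>"
  shows "sat M (min_of lt \<alpha> \<beta>) \<longleftrightarrow> lt \<alpha> \<beta>"
    and "sat M (min_of lt \<beta> \<alpha>) \<longleftrightarrow> \<not> lt \<beta> \<alpha>"
  using assms by (simp_all add: min_of_def)

lemma models_s_scheme_iff:
  assumes "total_ordering lt"
  shows "models_s M (min_of lt)
      (SImp (SConj \<phi> (SNeg \<psi>))
        (SIff (SChoice \<phi> \<psi>) (SChoice (SNeg \<phi>) (SNeg \<psi>)))) \<longleftrightarrow>
    (sat M (collapse (min_of lt) \<phi>) \<and> \<not> sat M (collapse (min_of lt) \<psi>) \<longrightarrow>
      (lt (collapse (min_of lt) \<phi>) (collapse (min_of lt) \<psi>) \<longleftrightarrow>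
        lt (Neg (collapse (min_of lt) \<psi>)) (Neg (collapse (min_of lt) \<phi>))))"
    (is "?scheme \<longleftrightarrow> (sat M ?\<alpha> \<and> \<not> sat M ?\<beta> \<longrightarrow> ?iff)")
proof (cases "sat M ?\<alpha> \<and> \<not> sat M ?\<beta>")
  case True
  then have "Neg ?\<alpha> \<noteq> Neg ?\<beta>"
    by auto
  then have "\<not> lt (Neg ?\<alpha>) (Neg ?\<beta>) \<longleftrightarrow> lt (Neg ?\<beta>) (Neg ?\<alpha>)"
    by (rule total_ordering_not_iff[OF assms])
  \<comment> \<open>Negation swaps the roles: here \<open>M\<close> satisfies
    \<open>Neg ?\<beta>\<close> and refutes \<open>Neg ?\<alpha>\<close>.\<close>
  moreover have "sat M (min_of lt (Neg ?\<alpha>) (Neg ?\<beta>)) \<longleftrightarrow> \<not> lt (Neg ?\<alpha>) (Neg ?\<beta>)"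
    using True by (intro sat_min_of(2)) simp_all
  moreover have "sat M (min_of lt ?\<alpha> ?\<beta>) \<longleftrightarrow> lt ?\<alpha> ?\<beta>"
    using True by (intro sat_min_of(1)) simp_all
  ultimately show ?thesis
    using True by (auto simp: models_s_def SImp_def SIff_def)
next
  case False
  then show ?thesis
    by (auto simp: models_s_def SImp_def)
qed

lemma neg_decreasing_iff_scheme:
  assumes "total_ordering lt"
  shows "neg_decreasing lt \<longleftrightarrow>
    (\<forall>M \<phi> \<psi>. models_s M (min_of lt)
      (SImp (SConj \<phi> (SNeg \<psi>))
        (SIff (SChoice \<phi> \<psi>) (SChoice (SNeg \<phi>) (SNeg \<psi>)))))"
    (is "_ \<longleftrightarrow> (\<forall>M \<phi> \<psi>. ?scheme M \<phi> \<psi>)")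
proof
  assume "neg_decreasing lt"
  \<comment> \<open>An \<open>M\<close> satisfying the premise of the scheme witnesses that the two
    collapses are inequivalent.\<close>
  then show "\<forall>M \<phi> \<psi>. ?scheme M \<phi> \<psi>"
    unfolding models_s_scheme_iff[OF assms] neg_decreasing_def equiv_form_def by blast
next
  assume scheme: "\<forall>M \<phi> \<psi>. ?scheme M \<phi> \<psi>"
  \<comment> \<open>Every sentence of L is the collapse of its own embedding, so the scheme reaches
    all pairs \<alpha>, \<beta>.\<close>
  have sep: "lt \<alpha> \<beta> \<longleftrightarrow> lt (Neg \<beta>) (Neg \<alpha>)" if "sat M \<alpha>" "\<not> sat M \<beta>" for M \<alpha> \<beta>
    using that scheme[unfolded models_s_scheme_iff[OF assms], rule_format,
        of M "embed \<alpha>" "embed \<beta>"]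
    by (simp add: collapse_embed)
  show "neg_decreasing lt"
    unfolding neg_decreasing_def
  proof (intro allI impI)
    fix \<alpha> \<beta>
    assume neq: "\<not> equiv_form \<alpha> \<beta>"
    then obtain M where "sat M \<alpha> \<noteq> sat M \<beta>"
      by (auto simp: equiv_form_def)
    then consider "sat M \<alpha>" "\<not> sat M \<beta>" | "sat M \<beta>" "\<not> sat M \<alpha>"
      by blast
    then show "lt \<alpha> \<beta> \<longleftrightarrow> lt (Neg \<beta>) (Neg \<alpha>)"
    proof cases
      case 1
      then show ?thesis by (rule sep)
    next
      case 2
      then have "lt \<beta> \<alpha> \<longleftrightarrow> lt (Neg \<alpha>) (Neg \<beta>)"
        by (rule sep)
      moreover have "\<alpha> \<noteq> \<beta>"
        using 2 by auto
      \<comment> \<open>Negating both sides of the swapped equivalence reverses both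
        comparisons.\<close>
      ultimately show ?thesis
        using total_ordering_not_iff[OF assms, of \<alpha> \<beta>]
          total_ordering_not_iff[OF assms, of "Neg \<alpha>" "Neg \<beta>"] by auto
    qed
  qed
qed

theorem theorem2p42:
  fixes f :: "form \<Rightarrow> form \<Rightarrow> form"
  assumes "choice_function f"
    and "\<exists>lt. total_ordering lt \<and> regular lt \<and> f = min_of lt"
  shows "neg_decreasing_choice f \<longleftrightarrow>
    (\<forall>M \<phi> \<psi>. models_s M f
      (SImp (SConj \<phi> (SNeg \<psi>))
        (SIff (SChoice \<phi> \<psi>) (SChoice (SNeg \<phi>) (SNeg \<psi>)))))"
proof -
  obtain lt where lt: "total_ordering lt" "regular lt" "f = min_of lt"
    using assms(2) by blast
  \<comment> \<open>Any ordering witnessing the left side represents \<open>f\<close>, hence equals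
    \<open>lt\<close>.\<close>
  then have "neg_decreasing_choice f \<longleftrightarrow> neg_decreasing lt"
    unfolding neg_decreasing_choice_def using min_of_inject by blast
  then show ?thesis
    using neg_decreasing_iff_scheme[OF lt(1)] lt(3) by simp
qed

end
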